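(* Let $(\mathbf{k};\mathbf{m})=(k_1,\dots,k_r;m_1,\dots,m_r)$ be an admissible bi-index. Then $$\zeta^{\mu}(\mathbf{k};\mathbf{m})=\int_{\Delta^{|\mathbf{k}|}}\omega^{\mu}_{(\mathbf{k};\mathbf{m})}.$$ Moreover, for every special triple $(\mathbf{k};\mathbf{m};\tilde{\mathbf{m}})$, $$\mathcal{D}^{\mu}(\mathbf{k};\mathbf{m};\tilde{\mathbf{m}})=\int_{\Delta^{|\mathbf{k}|}}\left(\omega^{\mu}_{(\mathbf{k};\mathbf{m})}-\omega^{\mu}_{(\mathbf{k};\tilde{\mathbf{m}})}\right).$$
   Context: Fix $\mu\in\mathbb{C}$ with $\mathrm{Re}(\mu)>0$. A bi-index is $(\mathbf{k};\mathbf{m})=(k_1,\dots,k_r;m_1,\dots,m_r)\in\mathbb{N}^r\times\mathbb{Q}^r$; its weight is $|\mathbf{k}|=k_1+\dots+k_r$. It is positive if all $m_i>0$ and admissible if it is positive and $k_r>1$. For admissible $(\mathbf{k};\mathbf{m})$, $\zeta^{\mu}(\mathbf{k};\mathbf{m})=\sum_{0\le n_1\le\cdots\le n_r}\frac{\mu^r}{(n_1\mu+m_1)^{k_1}\cdots(n_r\mu+m_r)^{k_r}}$. A special triple $(\mathbf{k};\mathbf{m};\tilde{\mathbf{m}})$ consists of $\mathbf{k}=(k_1,\dots,k_{r-1},1)\in\mathbb{N}^r$, $\mathbf{m}=(m_1,\dots,m_r)$, $\tilde{\mathbf{m}}=(m_1,\dots,m_{r-1},\tilde m_r)$ with all entries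 in $\mathbb{Q}_{>0}$ and $m_r\neq\tilde m_r$; then $\mathcal{D}^{\mu}(\mathbf{k};\mathbf{m};\tilde{\mathbf{m}})=(\tilde m_r-m_r)\sum_{0\le n_1\le\cdots\le n_r}\frac{\mu^r}{\prod_{i=1}^{r-1}(n_i\mu+m_i)^{k_i}\,(n_r\mu+m_r)(n_r\mu+\tilde m_r)}$. For $0<t\le1$ let $\Delta^n(t)=\{(t_1,\dots,t_n)\in\mathbb{R}^n:0<t_n<\cdots<t_1<t\}$, $\Delta^n=\Delta^n(1)$. Put $\omega_0(t)=\frac{dt}{t}$ and, for $a\in\mathbb{Q}$, $\omega^{(a)}_{1,\mu}(t)=\frac{\mu t^{a}\,dt}{t(1-t^{\mu})}$. For a positive bi-index with $n=|\mathbf{k}|$ and $m_0=0$, $\omega^{\mu}_{(\mathbf{k};\mathbf{m})}$ is the form $\phi_1(t_1)\cdots\phi_n(t_n)$ on $\Delta^n$ where the sequence $\phi_n,\phi_{n-1},\dots,\phi_1$ (read from the innermost variable $t_n$ to the outermost $t_1$) is $\omega^{(m_1)}_{1,\mu},\underbrace{\omega_0,\dots,\omega_0}_{k_1-1},\omega^{(m_2-m_1)}_{1,\mu},\underbrace{\omega_0,\dots,\omega_0}_{k_2-1},\dots,\omega^{(m_r-m_{r-1})}_{1,\mu},\underbrace{\omega_0,\dots,\omega_0}_{k_r-1}$; its integral over $\Delta^n(t)$ is the iterated integral $\int_{0<t_n<\dots<t_1<t}\prod_j f_j(t_j)\,dt_1\cdots dt_n$ where $\phi_j=f_j(t)\,dt$.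 For example $\omega^{\mu}_{(1,3;m_1,m_2)}=\omega^{(m_1)}_{1,\mu}(t_4)\,\omega^{(m_2-m_1)}_{1,\mu}(t_3)\,\omega_0(t_2)\,\omega_0(t_1)$. *)

theory Defs
  imports "HOL-Analysis.Analysis"
begin

text \<open>
  A bi-index of length \<open>r\<close> is a pair of lists of length \<open>r\<close>. List positions start at 0, so
  \<open>k\<^sub>i\<close> and \<open>m\<^sub>i\<close> are \<open>k ! (i - 1)\<close> and \<open>m ! (i - 1)\<close>. The entries of \<open>k\<close> are positive integers.
\<close>

definition bi_index :: "nat list \<Rightarrow> rat list \<Rightarrow> bool" where
  "bi_index k m \<longleftrightarrow> length m = length k \<and> (\<forall>a\<in>set k. 1 \<le> a)"

definition positive_bi_index :: "nat list \<Rightarrow> rat list \<Rightarrow> bool" where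
  "positive_bi_index k m \<longleftrightarrow> bi_index k m \<and> (\<forall>a\<in>set m. 0 < a)"

definition admissible :: "nat list \<Rightarrow> rat list \<Rightarrow> bool" where
  "admissible k m \<longleftrightarrow> positive_bi_index k m \<and> k \<noteq> [] \<and> 1 < last k"

definition special_triple :: "nat list \<Rightarrow> rat list \<Rightarrow> rat list \<Rightarrow> bool" where
  "special_triple k m m' \<longleftrightarrow>
     positive_bi_index k m \<and> positive_bi_index k m' \<and>
     k \<noteq> [] \<and> last k = 1 \<and> butlast m = butlast m' \<and> last m \<noteq> last m'"

definition weight :: "nat list \<Rightarrow> nat" where
  "weight k = sum_list k"

definition mono_tuples :: "nat \<Rightarrow> nat list set" where
  "mono_tuples r = {ns. length ns = r \<and> sorted ns}"

definition zeta_summand :: "complex \<Rightarrow> nat list \<Rightarrow> rat list \<Rightarrow> nat list \<Rightarrow> complex" where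
  "zeta_summand \<mu> k m ns =
     \<mu> ^ length k / (\<Prod>i<length k. (of_nat (ns ! i) * \<mu> + of_rat (m ! i)) ^ (k ! i))"

definition zeta_mu :: "complex \<Rightarrow> nat list \<Rightarrow> rat list \<Rightarrow> complex" where
  "zeta_mu \<mu> k m = (\<Sum>\<^sub>\<infinity>ns\<in>mono_tuples (length k). zeta_summand \<mu> k m ns)"

definition D_summand ::
    "complex \<Rightarrow> nat list \<Rightarrow> rat list \<Rightarrow> rat list \<Rightarrow> nat list \<Rightarrow> complex" where
  "D_summand \<mu> k m m' ns =
     \<mu> ^ length k /
       ((\<Prod>i<length k - 1. (of_nat (ns ! i) * \<mu> + of_rat (m ! i)) ^ (k ! i)) *
        (of_nat (last ns) * \<mu> + of_rat (last m)) *
        (of_nat (last ns) * \<mu> + of_rat (last m')))"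

definition D_mu :: "complex \<Rightarrow> nat list \<Rightarrow> rat list \<Rightarrow> rat list \<Rightarrow> complex" where
  "D_mu \<mu> k m m' =
     of_rat (last m' - last m) * (\<Sum>\<^sub>\<infinity>ns\<in>mono_tuples (length k). D_summand \<mu> k m m' ns)"

text \<open>
  Differential forms are represented by their densities with respect to Lebesgue measure, and
  points of \<open>\<real>\<^sup>n\<close> by extensional functions on \<open>{1..n}\<close>.
\<close>

definition simplex_to :: "nat \<Rightarrow> real \<Rightarrow> (nat \<Rightarrow> real) set" where
  "simplex_to n t =
     {x \<in> {1..n} \<rightarrow>\<^sub>E UNIV.
        (\<forall>j\<in>{1..n}. 0 < x j \<and> x j < t) \<and> (\<forall>i\<in>{1..n}. \<forall>j\<in>{1..n}. i < j \<longrightarrow> x j < x i)}"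

definition lebesgue_pow :: "nat \<Rightarrow> (nat \<Rightarrow> real) measure" where
  "lebesgue_pow n = Pi\<^sub>M {1..n} (\<lambda>_. lborel)"

definition omega0 :: "real \<Rightarrow> complex" where
  "omega0 t = 1 / of_real t"

definition omega1 :: "complex \<Rightarrow> rat \<Rightarrow> real \<Rightarrow> complex" where
  "omega1 \<mu> a t =
     \<mu> * of_real (t powr of_rat a) / (of_real t * (1 - of_real t powr \<mu>))"

text \<open>
  The sequence \<open>\<phi>\<^sub>n, \<dots>, \<phi>\<^sub>1\<close> from the innermost to the outermost variable. The list \<open>0 # m\<close>
  encodes the convention \<open>m\<^sub>0 = 0\<close>, so \<open>(0 # m) ! i\<close> is the predecessor of \<open>m ! i\<close>.
\<close>

definition forms :: "complex \<Rightarrow> nat list \<Rightarrow> rat list \<Rightarrow> (real \<Rightarrow> complex) list" where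
  "forms \<mu> k m =
     concat (map (\<lambda>i. omega1 \<mu> (m ! i - (0 # m) ! i) # replicate (k ! i - 1) omega0)
               [0..<length k])"

text \<open>\<open>\<phi>\<^sub>j\<close> is the entry of \<^const>\<open>forms\<close> at position \<open>n - j\<close>.\<close>

definition omega_form :: "complex \<Rightarrow> nat list \<Rightarrow> rat list \<Rightarrow> (nat \<Rightarrow> real) \<Rightarrow> complex" where
  "omega_form \<mu> k m x = (\<Prod>j=1..weight k. (forms \<mu> k m ! (weight k - j)) (x j))"

end

theory Submission
  imports Defs
begin

text \<open>
  Expanding every factor \<open>1 / (1 - t\<^sup>\<mu>)\<close> as a geometric series writes the form on the open simplex
  as a sum, over weakly increasing tuples \<open>n\<^sub>1 \<le> \<dots> \<le> n\<^sub>r\<close>, of monomials; the \<open>i\<close>-th series is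
  indexed by \<open>n\<^sub>i - n\<^bsub>i-1\<^esub>\<close>. Integrating a monomial from the innermost variable outwards gives
  the product of the reciprocals of the accumulated exponents, which are \<open>n\<^sub>i \<mu> + m\<^sub>i\<close>, each
  repeated \<open>k\<^sub>i\<close> times. Sum and integral may be exchanged because the norm of a monomial is the
  monomial with exponents replaced by their real parts, so that the sum of the integrals of the
  norms is the same kind of series with \<open>Re \<mu>\<close> in the denominators. For a special triple the two
  monomials differ by a positive real factor on the same side of 1 throughout the simplex, so the
  norm of their difference is again, up to sign, the difference of their norms.
\<close>

subsection \<open>Complex powers of positive reals\<close>

text \<open>An exponential rather than \<open>powr\<close>: the exponent law then has no side
  condition and measurability on all of the real line is immediate. Only positive bases matter,
  where both notions agree.\<close>

definition cpow :: "real \<Rightarrow> complex \<Rightarrow> complex" where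
  "cpow t z = exp (z * of_real (ln t))"

lemma cpow_add: "cpow t (a + b) = cpow t a * cpow t b"
  by (simp add: cpow_def exp_add distrib_right)

lemma cpow_eq_powr: "0 < t \<Longrightarrow> cpow t z = of_real t powr z"
  by (simp add: cpow_def powr_def Ln_of_real)

lemma cpow_of_real: "0 < t \<Longrightarrow> cpow t (of_real a) = of_real (t powr a)"
  by (simp add: cpow_def powr_def exp_of_real flip: of_real_mult)

lemma norm_cpow: "0 < t \<Longrightarrow> norm (cpow t z) = t powr Re z"
  by (simp add: cpow_def powr_def)

lemma cpow_minus_one: "0 < t \<Longrightarrow> cpow t (-1) = 1 / of_real t"
  by (simp add: cpow_def exp_minus Ln_of_real flip: exp_of_real) (simp add: exp_of_real field_simps)

lemma measurable_cpow [measurable]: "(\<lambda>t. cpow t z) \<in> borel_measurable borel"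
proof -
  have [measurable]: "(exp :: complex \<Rightarrow> complex) \<in> borel_measurable borel"
    by (intro borel_measurable_continuous_onI continuous_intros)
  show ?thesis unfolding cpow_def by measurable
qed

text \<open>The norm is the real power \<open>y powr (Re c - 1)\<close>, integrable at 0 because
  \<open>Re c > 0\<close>. Finiteness of this value yields integrability of the complex
  power.\<close>

lemma nn_integral_norm_cpow:
  assumes c: "0 < Re c" and b: "0 < b"
  shows "(\<integral>\<^sup>+ y. ennreal (norm (cpow y (c - 1))) * indicator {0<..<b} y \<partial>lborel)
           = ennreal (b powr Re c / Re c)"
proof -
  have "(\<integral>\<^sup>+ y. ennreal (norm (cpow y (c - 1))) * indicator {0<..<b} y \<partial>lborel)
      = (\<integral>\<^sup>+ y. ennreal (y powr (Re c - 1)) * indicator {0..b} y \<partial>lborel)"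
    by (intro nn_integral_cong_AE eventually_mono[OF eventually_conj[OF AE_lborel_singleton[of 0] AE_lborel_singleton[of b]]])
       (auto simp: norm_cpow split: split_indicator)
  also have "\<dots> = ennreal (b powr Re c / Re c)"
    using nn_integral_has_integral_lebesgue'[OF _ has_integral_powr_from_0[of "Re c - 1" b]] c b by simp
  finally show ?thesis .
qed

lemma integral_cpow:
  assumes c: "0 < Re c" and b: "0 < b"
  shows "(LINT y:{0<..<b}|lborel. cpow y (c - 1)) = cpow b c / c"
proof -
  let ?f = "\<lambda>y. of_real y powr (c - 1) :: complex"
  have c0: "c \<noteq> 0" using c by auto
  have int: "set_integrable lborel {0<..<b} (\<lambda>y. cpow y (c - 1))"
    unfolding set_integrable_def
  proof (rule integrableI_bounded)
    show "(\<lambda>y. indicat_real {0<..<b} y *\<^sub>R cpow y (c - 1)) \<in> borel_measurable lborel" by measurable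
    have "(\<integral>\<^sup>+ y. ennreal (norm (indicat_real {0<..<b} y *\<^sub>R cpow y (c - 1))) \<partial>lborel)
        = (\<integral>\<^sup>+ y. ennreal (norm (cpow y (c - 1))) * indicator {0<..<b} y \<partial>lborel)"
      by (intro nn_integral_cong) (auto split: split_indicator)
    then show "(\<integral>\<^sup>+ y. ennreal (norm (indicat_real {0<..<b} y *\<^sub>R cpow y (c - 1))) \<partial>lborel) < \<infinity>"
      using nn_integral_norm_cpow[OF c b] by simp
  qed
  have "(?f has_integral (of_real b powr c / c - of_real 0 powr c / c)) {0..b}"
  \<comment> \<open>The integrand may be unbounded at 0, so differentiability is used only in the
    interior. The antiderivative stays continuous at 0 because \<open>Re c > 0\<close>, and its
    value there is 0.\<close>
  proof (rule fundamental_theorem_of_calculus_interior)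
    show "0 \<le> b" using b by simp
    show "continuous_on {0..b} (\<lambda>y. of_real y powr c / c :: complex)"
      using c c0 by (intro continuous_intros continuous_on_powr_complex) auto
    fix x assume x: "x \<in> {0<..<b}"
    then have "complex_of_real x \<notin> \<real>\<^sub>\<le>\<^sub>0" by (simp add: complex_nonpos_Reals_iff)
    then have "((\<lambda>z. z powr c / c) has_field_derivative of_real x powr (c - 1)) (at (of_real x))"
      using c0 by (auto intro!: derivative_eq_intros)
    then show "((\<lambda>y. of_real y powr c / c) has_vector_derivative ?f x) (at x)"
      using has_vector_derivative_real_field[of "\<lambda>z. z powr c / c"] by (simp add: o_def)
  qed
  then have "(?f has_integral (cpow b c / c)) {0..b}"
    using b by (simp add: cpow_eq_powr)
  then have "(?f has_integral (cpow b c / c)) {0<..<b}"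
    by (simp add: has_integral_Icc_iff_Ioo)
  then have "((\<lambda>y. cpow y (c - 1)) has_integral (cpow b c / c)) {0<..<b}"
    by (rule has_integral_eq[rotated]) (simp add: cpow_eq_powr)
  then show ?thesis
    using set_borel_integral_eq_integral(2)[OF int] by (simp add: integral_unique)
qed

subsection \<open>Integrals of monomials over the simplex\<close>

text \<open>By transitivity the new innermost coordinate only has to lie below the previous one. The
  fibre over \<open>x\<close> is thus an interval starting at 0, ending at 1 when there is no
  previous coordinate, and the simplex can be integrated one variable at a time.\<close>

lemma simplex_to_Suc_iff:
  assumes "x \<in> space (lebesgue_pow n)"
  shows "x(Suc n := y) \<in> simplex_to (Suc n) 1 \<longleftrightarrow>
           x \<in> simplex_to n 1 \<and> 0 < y \<and> y < (if n = 0 then 1 else x n)"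
proof -
  have x: "x \<in> {1..n} \<rightarrow>\<^sub>E UNIV"
    using assms by (simp add: lebesgue_pow_def space_PiM)
  have xS: "x(Suc n := y) \<in> {1..Suc n} \<rightarrow>\<^sub>E UNIV"
    using x by (auto simp: PiE_def extensional_def)
  show ?thesis
  proof
    assume *: "x(Suc n := y) \<in> simplex_to (Suc n) 1"
    have 1: "0 < (x(Suc n := y)) j \<and> (x(Suc n := y)) j < 1" if "j \<in> {1..Suc n}" for j
      using * that unfolding simplex_to_def by blast
    have 2: "(x(Suc n := y)) j < (x(Suc n := y)) i" if "i \<in> {1..Suc n}" "j \<in> {1..Suc n}" "i < j" for i j
      using * that unfolding simplex_to_def by blast
    have "x \<in> simplex_to n 1"
      unfolding simplex_to_def
    proof (intro CollectI conjI ballI impI x)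
      fix j assume "j \<in> {1..n}" then show "0 < x j" "x j < 1" using 1[of j] by auto
    next
      fix i j assume "i \<in> {1..n}" "j \<in> {1..n}" "i < j" then show "x j < x i" using 2[of i j] by auto
    qed
    moreover have "0 < y" "y < (if n = 0 then 1 else x n)"
      using 1[of "Suc n"] 2[of n "Suc n"] by auto
    ultimately show "x \<in> simplex_to n 1 \<and> 0 < y \<and> y < (if n = 0 then 1 else x n)" by blast
  next
    assume *: "x \<in> simplex_to n 1 \<and> 0 < y \<and> y < (if n = 0 then 1 else x n)"
    have 1: "0 < x j \<and> x j < 1" if "j \<in> {1..n}" for j
      using * that unfolding simplex_to_def by blast
    have 2: "x j < x i" if "i \<in> {1..n}" "j \<in> {1..n}" "i < j" for i j
      using * that unfolding simplex_to_def by blast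
    have y: "y < x i" if "i \<in> {1..n}" for i
      using * 2[of i n] that by (cases "i = n") auto
    have y1: "y < 1" using * 1[of n] by (cases "n = 0") auto
    show "x(Suc n := y) \<in> simplex_to (Suc n) 1"
      unfolding simplex_to_def using * xS 1 2 y y1 by (auto simp: le_Suc_eq)
  qed
qed

lemma sets_simplex_to [measurable]: "simplex_to n t \<in> sets (lebesgue_pow n)"
proof -
  have "simplex_to n t = {x \<in> space (lebesgue_pow n).
        (\<forall>j\<in>{1..n}. 0 < x j \<and> x j < t) \<and> (\<forall>i\<in>{1..n}. \<forall>j\<in>{1..n}. i < j \<longrightarrow> x j < x i)}"
    by (simp add: simplex_to_def lebesgue_pow_def space_PiM)
  also have "\<dots> \<in> sets (lebesgue_pow n)"
    unfolding lebesgue_pow_def by measurable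
  finally show ?thesis .
qed

text \<open>
  The exponents are prescribed through their partial sums from the innermost variable on: integrating
  out \<open>x\<^bsub>j+1\<^esub>, \<dots>, x\<^sub>n\<close> contributes \<open>x\<^sub>j\<close> to the power \<open>C\<^bsub>j+1\<^esub>\<close> and leaves \<open>x\<^sub>j\<close> to the power \<open>C\<^sub>j - 1\<close>.
\<close>

definition simplex_monomial :: "nat \<Rightarrow> (nat \<Rightarrow> complex) \<Rightarrow> (nat \<Rightarrow> real) \<Rightarrow> complex" where
  "simplex_monomial n C x =
     (\<Prod>j=1..n. cpow (x j) (C j - (if j = n then 0 else C (Suc j)) - 1))"

lemma measurable_simplex_monomial [measurable]:
  "simplex_monomial n C \<in> borel_measurable (lebesgue_pow n)"
  unfolding simplex_monomial_def lebesgue_pow_def by measurable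

text \<open>When \<open>n > 0\<close>, the variable \<open>x n\<close> is no longer the innermost
  one, so its exponent drops by \<open>C (Suc n)\<close>. The resulting factor cancels the power of
  \<open>x n\<close> that integrating \<open>y\<close> over \<open>{0<..<x n}\<close>
  produces.\<close>

lemma simplex_monomial_Suc:
  "simplex_monomial (Suc n) C (x(Suc n := y)) =
     (if n = 0 then 1 else cpow (x n) (- C (Suc n))) * simplex_monomial n C x * cpow y (C (Suc n) - 1)"
proof (cases "n = 0")
  case False
  then obtain n' where n: "n = Suc n'" by (cases n) auto
  have "(\<Prod>j=1..n'. cpow ((x(Suc n := y)) j) (C j - (if j = Suc n then 0 else C (Suc j)) - 1)) =
        (\<Prod>j=1..n'. cpow (x j) (C j - (if j = n then 0 else C (Suc j)) - 1))"
    using n by (intro prod.cong) auto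
  moreover have "cpow (x n) (C n - C (Suc n) - 1) = cpow (x n) (- C (Suc n)) * cpow (x n) (C n - 1)"
    by (simp flip: cpow_add add: algebra_simps)
  ultimately show ?thesis
    using n by (simp add: simplex_monomial_def)
qed (simp add: simplex_monomial_def)

lemma insert_Suc_interval: "{1..Suc n} = insert (Suc n) {1..n}"
  by auto

interpretation lborel_product: product_sigma_finite "\<lambda>_::nat. lborel :: real measure"
  by standard

text \<open>Tonelli, peeling off the innermost variable: each step contributes one reciprocal and
  leaves the monomial in one variable fewer. In dimension 0 the space is a single point with mass
  1.\<close>

lemma nn_integral_simplex_monomial:
  assumes "\<And>j. j \<in> {1..n} \<Longrightarrow> 0 < Re (C j)"
  shows "(\<integral>\<^sup>+ x. ennreal (norm (simplex_monomial n C x)) * indicator (simplex_to n 1) x \<partial>lebesgue_pow n)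
           = ennreal (\<Prod>j=1..n. 1 / Re (C j))"
  using assms
proof (induction n)
  case 0
  have "(\<lambda>_. undefined) \<in> simplex_to 0 1" by (auto simp: simplex_to_def)
  then show ?case
    by (simp add: lebesgue_pow_def PiM_empty simplex_monomial_def nn_integral_count_space_finite)
next
  case (Suc n)
  let ?c = "C (Suc n)"
  let ?S = "\<lambda>n. indicator (simplex_to n 1) :: _ \<Rightarrow> ennreal"
  let ?b = "\<lambda>x. if n = 0 then 1 else x n :: real"
  have c: "0 < Re ?c" using Suc.prems by simp
  have [measurable]: "simplex_to (Suc n) 1 \<in> sets (Pi\<^sub>M (insert (Suc n) {1..n}) (\<lambda>_. lborel))"
    using sets_simplex_to[of "Suc n" 1] unfolding lebesgue_pow_def insert_Suc_interval .
  have [measurable]: "simplex_monomial (Suc n) C \<in> borel_measurable (Pi\<^sub>M (insert (Suc n) {1..n}) (\<lambda>_. lborel))"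
    using measurable_simplex_monomial[of "Suc n" C] unfolding lebesgue_pow_def insert_Suc_interval .
  have "(\<integral>\<^sup>+ x. ennreal (norm (simplex_monomial (Suc n) C x)) * ?S (Suc n) x \<partial>lebesgue_pow (Suc n)) =
     (\<integral>\<^sup>+ x. \<integral>\<^sup>+ y. ennreal (norm (simplex_monomial (Suc n) C (x(Suc n := y)))) * ?S (Suc n) (x(Suc n := y))
         \<partial>lborel \<partial>lebesgue_pow n)"
    unfolding lebesgue_pow_def insert_Suc_interval
    by (rule lborel_product.product_nn_integral_insert) (simp, simp, measurable)
  also have "\<dots> = (\<integral>\<^sup>+ x. ennreal (1 / Re ?c) * (ennreal (norm (simplex_monomial n C x)) * ?S n x) \<partial>lebesgue_pow n)"
  proof (rule nn_integral_cong)
    fix x assume x: "x \<in> space (lebesgue_pow n)"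
    show "(\<integral>\<^sup>+ y. ennreal (norm (simplex_monomial (Suc n) C (x(Suc n := y)))) * ?S (Suc n) (x(Suc n := y)) \<partial>lborel)
        = ennreal (1 / Re ?c) * (ennreal (norm (simplex_monomial n C x)) * ?S n x)"
    proof (cases "x \<in> simplex_to n 1")
      case True
      then have b: "0 < ?b x" by (auto simp: simplex_to_def)
      let ?K = "norm ((if n = 0 then 1 else cpow (x n) (- ?c)) * simplex_monomial n C x)"
      have "(\<integral>\<^sup>+ y. ennreal (norm (simplex_monomial (Suc n) C (x(Suc n := y)))) * ?S (Suc n) (x(Suc n := y)) \<partial>lborel)
         = (\<integral>\<^sup>+ y. ennreal ?K * (ennreal (norm (cpow y (?c - 1))) * indicator {0<..<?b x} y) \<partial>lborel)"
        using True
        by (intro nn_integral_cong)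
           (auto simp: simplex_monomial_Suc simplex_to_Suc_iff[OF x] norm_mult ennreal_mult indicator_def mult.assoc)
      also have "\<dots> = ennreal ?K * ennreal (?b x powr Re ?c / Re ?c)"
        by (subst nn_integral_cmult) (use nn_integral_norm_cpow[OF c b] in \<open>auto\<close>)
      also have "\<dots> = ennreal (1 / Re ?c * norm (simplex_monomial n C x))"
        using b c by (auto simp: norm_mult norm_cpow powr_minus field_simps simp flip: ennreal_mult)
      finally show ?thesis using True c by (subst (asm) ennreal_mult) auto
    qed (simp add: simplex_to_Suc_iff[OF x] )
  qed
  also have "\<dots> = ennreal (1 / Re ?c) * ennreal (\<Prod>j=1..n. 1 / Re (C j))"
    using Suc by (subst nn_integral_cmult) auto
  also have "\<dots> = ennreal (\<Prod>j=1..Suc n. 1 / Re (C j))"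
    using c by (simp add: mult.commute flip: ennreal_mult')
  finally show ?case .
qed

lemma norm_indicator_scaleR:
  "norm (indicat_real S x *\<^sub>R f x) = indicat_real S x *\<^sub>R norm (f x)"
  by (simp add: indicator_def)

text \<open>Integrability is the hypothesis for Fubini in the complex computation; the integral of
  the norm supplies the terms of the series that justifies exchanging sum and integral.\<close>

lemma set_integral_norm_simplex_monomial:
  assumes "\<And>j. j \<in> {1..n} \<Longrightarrow> 0 < Re (C j)"
  shows "set_integrable (lebesgue_pow n) (simplex_to n 1) (simplex_monomial n C)"
    and "(LINT x:simplex_to n 1|lebesgue_pow n. norm (simplex_monomial n C x)) = (\<Prod>j=1..n. 1 / Re (C j))"
proof -
  have *: "(\<integral>\<^sup>+ x. ennreal (indicat_real (simplex_to n 1) x *\<^sub>R norm (simplex_monomial n C x)) \<partial>lebesgue_pow n) =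
      ennreal (\<Prod>j=1..n. 1 / Re (C j))"
    using nn_integral_simplex_monomial[OF assms]
    by (simp add: ennreal_mult'' ennreal_indicator mult.commute)
  have "0 \<le> (\<Prod>j=1..n. 1 / Re (C j))"
    using assms by (intro prod_nonneg) (auto simp: less_imp_le)
  from has_bochner_integral_nn_integral[OF _ _ this *]
  show "(LINT x:simplex_to n 1|lebesgue_pow n. norm (simplex_monomial n C x)) = (\<Prod>j=1..n. 1 / Re (C j))"
    by (simp add: set_lebesgue_integral_def has_bochner_integral_iff)
  show "set_integrable (lebesgue_pow n) (simplex_to n 1) (simplex_monomial n C)"
    unfolding set_integrable_def
    by (rule integrableI_bounded)
       (measurable, simp add: norm_indicator_scaleR[of _ _ "simplex_monomial n C"] * del: real_scaleR_def norm_scaleR)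
qed

text \<open>The same induction as for the norms, with Fubini in place of Tonelli.\<close>

lemma set_integral_simplex_monomial:
  assumes "\<And>j. j \<in> {1..n} \<Longrightarrow> 0 < Re (C j)"
  shows "(LINT x:simplex_to n 1|lebesgue_pow n. simplex_monomial n C x) = (\<Prod>j=1..n. 1 / C j)"
  using assms
proof (induction n)
  case 0
  have "(\<lambda>_. undefined) \<in> simplex_to 0 1" by (auto simp: simplex_to_def)
  then show ?case
    by (simp add: lebesgue_pow_def PiM_empty simplex_monomial_def set_lebesgue_integral_def
        lebesgue_integral_count_space_finite)
next
  case (Suc n)
  let ?c = "C (Suc n)"
  let ?S = "\<lambda>n. indicat_real (simplex_to n 1)"
  let ?b = "\<lambda>x. if n = 0 then 1 else x n :: real"
  have c: "0 < Re ?c" using Suc.prems by simp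
  have int: "integrable (Pi\<^sub>M (insert (Suc n) {1..n}) (\<lambda>_. lborel))
      (\<lambda>x. ?S (Suc n) x *\<^sub>R simplex_monomial (Suc n) C x)"
    using set_integral_norm_simplex_monomial(1)[of "Suc n" C, OF Suc.prems]
    unfolding set_integrable_def lebesgue_pow_def insert_Suc_interval .
  have "(LINT x:simplex_to (Suc n) 1|lebesgue_pow (Suc n). simplex_monomial (Suc n) C x) =
     (\<integral>x. \<integral>y. ?S (Suc n) (x(Suc n := y)) *\<^sub>R simplex_monomial (Suc n) C (x(Suc n := y))
         \<partial>lborel \<partial>lebesgue_pow n)"
    unfolding lebesgue_pow_def insert_Suc_interval set_lebesgue_integral_def
    by (rule lborel_product.product_integral_insert[OF _ _ int]) auto
  also have "\<dots> = (\<integral>x. (1 / ?c) * (?S n x *\<^sub>R simplex_monomial n C x) \<partial>lebesgue_pow n)"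
  proof (rule Bochner_Integration.integral_cong[OF refl])
    fix x assume x: "x \<in> space (lebesgue_pow n)"
    show "(\<integral>y. ?S (Suc n) (x(Suc n := y)) *\<^sub>R simplex_monomial (Suc n) C (x(Suc n := y)) \<partial>lborel)
        = (1 / ?c) * (?S n x *\<^sub>R simplex_monomial n C x)"
    proof (cases "x \<in> simplex_to n 1")
      case True
      then have b: "0 < ?b x" by (auto simp: simplex_to_def)
      let ?K = "(if n = 0 then 1 else cpow (x n) (- ?c)) * simplex_monomial n C x"
      have "(\<integral>y. ?S (Suc n) (x(Suc n := y)) *\<^sub>R simplex_monomial (Suc n) C (x(Suc n := y)) \<partial>lborel)
         = (\<integral>y. ?K * (indicat_real {0<..<?b x} y *\<^sub>R cpow y (?c - 1)) \<partial>lborel)"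
        using True
        by (intro Bochner_Integration.integral_cong)
           (auto simp: simplex_monomial_Suc simplex_to_Suc_iff[OF x] indicator_def mult.assoc)
      also have "\<dots> = ?K * (cpow (?b x) ?c / ?c)"
        by (subst integral_mult_right_zero) (use integral_cpow[OF c b] in \<open>simp only: set_lebesgue_integral_def\<close>)
      \<comment> \<open>The upper endpoint enters with the power \<open>?c\<close> and cancels the
        factor with power \<open>- ?c\<close>; for \<open>n = 0\<close> the endpoint is 1, whose
        powers are all 1.\<close>
      also have "\<dots> = 1 / ?c * simplex_monomial n C x"
      proof -
        have "cpow (x n) (- ?c) * cpow (x n) ?c = 1"
          by (simp flip: cpow_add) (simp add: cpow_def)
        moreover have "cpow 1 ?c = 1" by (simp add: cpow_def)
        ultimately show ?thesis by (auto simp: field_simps)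
      qed
      finally show ?thesis using True c by simp
    qed (simp add: simplex_to_Suc_iff[OF x] )
  qed
  also have "\<dots> = 1 / ?c * (LINT x:simplex_to n 1|lebesgue_pow n. simplex_monomial n C x)"
    unfolding set_lebesgue_integral_def by (rule integral_mult_right_zero)
  also have "\<dots> = (\<Prod>j=1..Suc n. 1 / C j)"
    using Suc by simp
  finally show ?case .
qed

subsection \<open>Sums over weakly increasing tuples\<close>

text \<open>Dominated exchange of sum and integral. Enumerating \<open>A\<close> by the natural
  numbers reduces it to the statement about sequences of integrable functions.\<close>

lemma has_sum_integral:
  fixes f :: "'i \<Rightarrow> 'a \<Rightarrow> complex"
  assumes A: "countable A" "infinite A"
    and int: "\<And>i. i \<in> A \<Longrightarrow> integrable M (f i)"
    and summ: "(\<lambda>i. \<integral>x. norm (f i x) \<partial>M) summable_on A"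
    and pt: "\<And>x. x \<in> space M \<Longrightarrow> ((\<lambda>i. f i x) has_sum F x) A"
  shows "integrable M F" and "((\<lambda>i. \<integral>x. f i x \<partial>M) has_sum (\<integral>x. F x \<partial>M)) A"
proof -
  obtain e :: "nat \<Rightarrow> 'i" where e: "bij_betw e UNIV A"
    using A by (rule countable_infiniteE')
  have eA: "e n \<in> A" for n using e by (auto simp: bij_betw_def)
  have pt': "((\<lambda>n. f (e n) x) has_sum F x) UNIV" if "x \<in> space M" for x
    using pt[OF that] has_sum_reindex_bij_betw[OF e, of "\<lambda>i. f i x"] by simp
  have suminf: "(\<Sum>n. f (e n) x) = F x" if "x \<in> space M" for x
    using has_sum_imp_sums[OF pt'[OF that]] by (simp add: sums_iff)
  \<comment> \<open>Unconditional convergence of a complex series is absolute, so the pointwise sums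
    already give summability of the norms.\<close>
  have ae: "AE x in M. summable (\<lambda>n. norm (f (e n) x))"
  proof (rule AE_I2)
    fix x assume "x \<in> space M"
    then have "(\<lambda>n. f (e n) x) summable_on UNIV"
      using pt' by (auto simp: summable_on_def)
    then show "summable (\<lambda>n. norm (f (e n) x))"
      by (intro summable_on_imp_summable) (simp add: summable_on_iff_abs_summable_on_complex)
  qed
  have summ': "summable (\<lambda>n. \<integral>x. norm (f (e n) x) \<partial>M)"
    using summ summable_on_reindex_bij_betw[OF e, of "\<lambda>i. \<integral>x. norm (f i x) \<partial>M"]
    by (intro summable_on_imp_summable) simp
  note * = integrable_suminf[OF int[OF eA] ae summ'] sums_integral[OF int[OF eA] ae summ']
  show "integrable M F"
    using *(1) suminf by (simp cong: Bochner_Integration.integrable_cong)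
  have "(\<lambda>n. \<integral>x. f (e n) x \<partial>M) sums (\<integral>x. F x \<partial>M)"
    using *(2) suminf by (simp cong: Bochner_Integration.integral_cong)
  \<comment> \<open>Passing from an ordered series back to an unordered sum needs absolute
    convergence; the norm of an integral is at most the integral of the norm.\<close>
  moreover have "summable (\<lambda>n. norm (\<integral>x. f (e n) x \<partial>M))"
    by (rule summable_comparison_test'[OF summ']) simp
  ultimately have "((\<lambda>n. \<integral>x. f (e n) x \<partial>M) has_sum (\<integral>x. F x \<partial>M)) UNIV"
    by (intro norm_summable_imp_has_sum)
  then show "((\<lambda>i. \<integral>x. f i x \<partial>M) has_sum (\<integral>x. F x \<partial>M)) A"
    using has_sum_reindex_bij_betw[OF e, of "\<lambda>i. \<integral>x. f i x \<partial>M"] by simp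
qed

text \<open>The factors converge absolutely, being unconditionally convergent complex series, so a
  finite product of them may be multiplied out.\<close>

lemma has_sum_prod_PiE:
  fixes f :: "'i \<Rightarrow> nat \<Rightarrow> complex"
  assumes I: "finite I" and f: "\<And>i. i \<in> I \<Longrightarrow> (f i has_sum s i) UNIV"
  shows "((\<lambda>g. \<Prod>i\<in>I. f i (g i)) has_sum (\<Prod>i\<in>I. s i)) (I \<rightarrow>\<^sub>E UNIV)"
proof -
  have abs: "(\<lambda>n. norm (f i n)) summable_on UNIV" if "i \<in> I" for i
    using has_sum_imp_summable[OF f[OF that]] by (simp add: summable_on_iff_abs_summable_on_complex)
  have "(\<lambda>g. \<Prod>i\<in>I. f i (g i)) summable_on (I \<rightarrow>\<^sub>E UNIV)"
    by (rule abs_summable_summable)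
       (use I abs in \<open>auto simp: abs_summable_equivalent intro!: abs_summable_on_prod_PiE\<close>)
  moreover have "infsum (\<lambda>g. \<Prod>i\<in>I. f i (g i)) (I \<rightarrow>\<^sub>E UNIV) = (\<Prod>i\<in>I. infsum (f i) UNIV)"
    by (rule infsum_prod_PiE_abs) (use I abs in auto)
  moreover have "(\<Prod>i\<in>I. infsum (f i) UNIV) = (\<Prod>i\<in>I. s i)"
    by (intro prod.cong refl infsumI f)
  ultimately show ?thesis
    using has_sum_infsum by metis
qed

text \<open>The sum telescopes, with \<open>0 # ns\<close> supplying the starting value 0;
  sortedness keeps the truncated subtraction exact.\<close>

lemma sum_nth_differences:
  assumes "sorted ns" "i < length ns"
  shows "(\<Sum>j\<le>i. ns ! j - (0 # ns) ! j) = (ns ! i :: nat)"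
  using assms(2)
proof (induction i)
  case (Suc i)
  have "ns ! i \<le> ns ! Suc i"
    using assms Suc.prems by (intro sorted_nth_mono) auto
  then show ?case using Suc by simp
qed simp

text \<open>A weakly increasing tuple is determined by its gaps, which are arbitrary naturals;
  partial sums recover the tuple. The gaps are the independent indices of the geometric
  series.\<close>

lemma has_sum_mono_tuples_iff:
  fixes g :: "(nat \<Rightarrow> nat) \<Rightarrow> 'a :: {comm_monoid_add, topological_space}"
  shows "((\<lambda>ns. g (\<lambda>i\<in>{..<r}. ns ! i - (0 # ns) ! i)) has_sum S) (mono_tuples r) \<longleftrightarrow>
         (g has_sum S) ({..<r} \<rightarrow>\<^sub>E UNIV)"
proof (rule has_sum_reindex_bij_witness[where i = "\<lambda>l. map (\<lambda>i. \<Sum>j\<le>i. l j) [0..<r]"])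
  fix ns assume "ns \<in> mono_tuples r"
  then show "map (\<lambda>i. \<Sum>j\<le>i. (\<lambda>i\<in>{..<r}. ns ! i - (0 # ns) ! i) j) [0..<r] = ns"
    by (intro nth_equalityI) (auto simp: mono_tuples_def sum_nth_differences cong: sum.cong_simp)
next
  fix l :: "nat \<Rightarrow> nat" assume l: "l \<in> {..<r} \<rightarrow>\<^sub>E UNIV"
  show "(\<lambda>i\<in>{..<r}. map (\<lambda>i. \<Sum>j\<le>i. l j) [0..<r] ! i - (0 # map (\<lambda>i. \<Sum>j\<le>i. l j) [0..<r]) ! i) = l"
  proof
    fix i show "(\<lambda>i\<in>{..<r}. map (\<lambda>i. \<Sum>j\<le>i. l j) [0..<r] ! i - (0 # map (\<lambda>i. \<Sum>j\<le>i. l j) [0..<r]) ! i) i = l i"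
      using l by (cases i) (auto simp: PiE_def extensional_def)
  qed
  show "map (\<lambda>i. \<Sum>j\<le>i. l j) [0..<r] \<in> mono_tuples r"
    by (auto simp: mono_tuples_def sorted_iff_nth_mono intro!: sum_mono2)
qed (simp_all only: restrict_PiE_iff UNIV_I ball_triv simp_thms)

section \<open>Convergence of the dominating series\<close>

text \<open>The surplus factor in the last entry is shared equally among all \<open>r + 1\<close>
  factors. Each then has exponent \<open>1 + 1 / (r + 1)\<close>, and the sum is dominated by a
  product of convergent p-series.\<close>

lemma summable_on_mono_tuples_reciprocals:
  "(\<lambda>ns. (\<Prod>i<Suc r. 1 / (real (ns ! i) + 1)) * (1 / (real (last ns) + 1))) summable_on mono_tuples (Suc r)"
proof -
  define p where "p = - (1 + 1 / real (Suc r))"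
  have "summable (\<lambda>n. real (Suc n) powr p)"
    by (subst summable_Suc_iff[of "\<lambda>n. real n powr p"]) (simp add: summable_real_powr_iff p_def)
  then have 1: "(\<lambda>n. norm (complex_of_real ((real n + 1) powr p))) summable_on UNIV"
    by (simp add: summable_on_UNIV_nonneg_real_iff add.commute)
  \<comment> \<open>\<open>h\<close> embeds the tuples injectively into a full box of functions, so
    their sum is a subsum of one that factorises.\<close>
  define h where "h ns = (\<lambda>i\<in>{..<Suc r}. ns ! i)" for ns :: "nat list"
  have "(\<lambda>g. \<Prod>i<Suc r. complex_of_real ((real (g i) + 1) powr p)) summable_on ({..<Suc r} \<rightarrow>\<^sub>E UNIV)"
    using has_sum_prod_PiE[OF finite_lessThan has_sum_infsum[OF abs_summable_summable[OF 1]]]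
    by (blast intro: has_sum_imp_summable)
  then have "(\<lambda>g. \<Prod>i<Suc r. (real (g i) + 1) powr p) summable_on ({..<Suc r} \<rightarrow>\<^sub>E UNIV)"
    by (simp add: summable_on_iff_abs_summable_on_complex norm_mult prod_norm[symmetric])
  then have "(\<lambda>g. \<Prod>i<Suc r. (real (g i) + 1) powr p) summable_on h ` mono_tuples (Suc r)"
    by (rule summable_on_subset_banach) (simp only: h_def image_subset_iff restrict_PiE_iff, simp)
  moreover have "inj_on h (mono_tuples (Suc r))"
  proof (rule inj_onI)
    fix a b assume a: "a \<in> mono_tuples (Suc r)" "b \<in> mono_tuples (Suc r)" "h a = h b"
    have "a ! i = b ! i" if "i < Suc r" for i
      using fun_cong[OF a(3), of i] that by (simp add: h_def)
    then show "a = b"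
      using a by (intro nth_equalityI) (auto simp: mono_tuples_def)
  qed
  ultimately have "((\<lambda>g. \<Prod>i<Suc r. (real (g i) + 1) powr p) \<circ> h) summable_on mono_tuples (Suc r)"
    by (simp add: summable_on_reindex)
  then have "(\<lambda>ns. \<Prod>i<Suc r. (real (ns ! i) + 1) powr p) summable_on mono_tuples (Suc r)"
    by (simp add: h_def o_def cong: prod.cong_simp)
  then show ?thesis
  proof (rule summable_on_comparison_test)
    fix ns assume ns: "ns \<in> mono_tuples (Suc r)"
    then have len: "length ns = Suc r" and srt: "sorted ns" by (auto simp: mono_tuples_def)
    have last: "last ns = ns ! r" using len by (subst last_conv_nth) auto
    \<comment> \<open>every entry is at most the last one, which therefore pays \<open>(n\<^sub>i + 1)\<^bsup>1/(r+1)\<^esup>\<close> for each of them\<close>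
    let ?L = "real (last ns) + 1"
    have "1 / ?L = ?L powr (real (Suc r) * - (1 / real (Suc r)))"
      by (simp add: powr_minus_divide del: of_nat_Suc)
    also have "\<dots> = (\<Prod>i<Suc r. ?L powr (- (1 / real (Suc r))))"
      by (simp only: prod_constant card_lessThan) (subst powr_power, simp_all del: of_nat_Suc power_Suc)
    also have "\<dots> \<le> (\<Prod>i<Suc r. (real (ns ! i) + 1) powr (- (1 / real (Suc r))))"
    proof (rule prod_mono, intro conjI)
      fix i assume "i \<in> {..<Suc r}"
      then have "ns ! i \<le> last ns"
        using len srt unfolding last by (intro sorted_nth_mono) auto
      then show "?L powr (- (1 / real (Suc r))) \<le> (real (ns ! i) + 1) powr (- (1 / real (Suc r)))"
        by (intro powr_mono2') auto
    qed auto
    finally have "(\<Prod>i<Suc r. 1 / (real (ns ! i) + 1)) * (1 / ?L) \<le>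
        (\<Prod>i<Suc r. 1 / (real (ns ! i) + 1)) * (\<Prod>i<Suc r. (real (ns ! i) + 1) powr (- (1 / real (Suc r))))"
      by (intro mult_left_mono prod_nonneg) auto
    also have "\<dots> = (\<Prod>i<Suc r. (real (ns ! i) + 1) powr p)"
      unfolding prod.distrib[symmetric] p_def
      by (intro prod.cong refl) (simp add: powr_diff powr_minus_divide)
    finally show "(\<Prod>i<Suc r. 1 / (real (ns ! i) + 1)) * (1 / ?L) \<le> (\<Prod>i<Suc r. (real (ns ! i) + 1) powr p)" .
  next
    fix ns :: "nat list"
    show "0 \<le> (\<Prod>i<Suc r. 1 / (real (ns ! i) + 1)) * (1 / (real (last ns) + 1))"
      by (intro mult_nonneg_nonneg prod_nonneg) auto
  qed
qed

text \<open>The denominator is at least \<open>min \<rho> w * (real n + 1)\<close>, and surplus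
  powers of \<open>1 / (real n + 1)\<close>, a number at most 1, are discarded.\<close>

lemma inverse_linear_power_le:
  fixes \<rho> w :: real
  assumes "0 < \<rho>" "0 < w" "1 \<le> e"
  shows "(1 / (real n * \<rho> + w)) ^ e \<le> (1 / min \<rho> w) ^ e * (1 / (real n + 1))"
proof -
  let ?d = "min \<rho> w"
  have d: "0 < ?d" using assms by simp
  have "?d * (real n + 1) = real n * ?d + ?d" by (simp add: algebra_simps)
  also have "\<dots> \<le> real n * \<rho> + w" by (intro add_mono mult_left_mono) auto
  finally have "1 / (real n * \<rho> + w) \<le> 1 / (?d * (real n + 1))"
    using d by (intro frac_le) auto
  then have "(1 / (real n * \<rho> + w)) ^ e \<le> (1 / (?d * (real n + 1))) ^ e"
    using assms by (intro power_mono) auto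
  also have "\<dots> = (1 / ?d) ^ e * (1 / (real n + 1)) ^ e"
    by (simp add: power_divide power_mult_distrib)
  also have "\<dots> \<le> (1 / ?d) ^ e * (1 / (real n + 1)) ^ 1"
    using d assms by (intro mult_left_mono power_decreasing) auto
  finally show ?thesis by simp
qed

text \<open>One extra factor in the last index is kept apart so that both cases fit: it is a spare
  power of the last denominator for an admissible bi-index, and the second last denominator for a
  special triple.\<close>

lemma summable_on_mono_tuples_powers:
  fixes \<rho> :: real and w :: "nat \<Rightarrow> real"
  assumes \<rho>: "0 < \<rho>" and w: "\<And>i. i < Suc r \<Longrightarrow> 0 < w i" "0 < w'" and e: "\<And>i. i < Suc r \<Longrightarrow> 1 \<le> e i"
  shows "(\<lambda>ns. (\<Prod>i<Suc r. (1 / (real (ns ! i) * \<rho> + w i)) ^ e i) * (1 / (real (last ns) * \<rho> + w')))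
           summable_on mono_tuples (Suc r)"
proof -
  define K where "K = (\<Prod>i<Suc r. (1 / min \<rho> (w i)) ^ e i) * (1 / min \<rho> w')"
  have "(\<lambda>ns. K * ((\<Prod>i<Suc r. 1 / (real (ns ! i) + 1)) * (1 / (real (last ns) + 1)))) summable_on mono_tuples (Suc r)"
    by (intro summable_on_cmult_right summable_on_mono_tuples_reciprocals)
  then show ?thesis
  proof (rule summable_on_comparison_test)
    fix ns :: "nat list"
    have nn: "0 \<le> (1 / (real n * \<rho> + w i)) ^ e i" if "i < Suc r" for n i
      using \<rho> w(1)[OF that] by auto
    have "(\<Prod>i<Suc r. (1 / (real (ns ! i) * \<rho> + w i)) ^ e i) \<le>
          (\<Prod>i<Suc r. (1 / min \<rho> (w i)) ^ e i * (1 / (real (ns ! i) + 1)))"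
      using nn w e \<rho> by (intro prod_mono conjI inverse_linear_power_le) auto
    moreover have "1 / (real (last ns) * \<rho> + w') \<le> (1 / min \<rho> w') * (1 / (real (last ns) + 1))"
      using inverse_linear_power_le[OF \<rho> w(2), of 1 "last ns"] by simp
    moreover have "0 \<le> (\<Prod>i<Suc r. (1 / min \<rho> (w i)) ^ e i * (1 / (real (ns ! i) + 1)))"
      using w \<rho> by (intro prod_nonneg) (auto simp: less_imp_le)
    ultimately have "(\<Prod>i<Suc r. (1 / (real (ns ! i) * \<rho> + w i)) ^ e i) * (1 / (real (last ns) * \<rho> + w')) \<le>
          (\<Prod>i<Suc r. (1 / min \<rho> (w i)) ^ e i * (1 / (real (ns ! i) + 1))) * ((1 / min \<rho> w') * (1 / (real (last ns) + 1)))"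
      using \<rho> w(2) by (intro mult_mono) auto
    also have "\<dots> = K * ((\<Prod>i<Suc r. 1 / (real (ns ! i) + 1)) * (1 / (real (last ns) + 1)))"
      unfolding K_def prod.distrib by (simp only: mult_ac)
    finally show "(\<Prod>i<Suc r. (1 / (real (ns ! i) * \<rho> + w i)) ^ e i) * (1 / (real (last ns) * \<rho> + w')) \<le>
       K * ((\<Prod>i<Suc r. 1 / (real (ns ! i) + 1)) * (1 / (real (last ns) + 1)))" .
    show "0 \<le> (\<Prod>i<Suc r. (1 / (real (ns ! i) * \<rho> + w i)) ^ e i) * (1 / (real (last ns) * \<rho> + w'))"
      using nn \<rho> w(2) by (intro mult_nonneg_nonneg prod_nonneg) auto
  qed
qed

lemma countable_mono_tuples: "countable (mono_tuples r)"
  by (rule countable_subset[OF subset_UNIV]) simp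

lemma infinite_mono_tuples: "infinite (mono_tuples (Suc r))"
proof -
  have "inj (\<lambda>n. replicate (Suc r) (n :: nat))" by (auto intro: injI)
  moreover have "range (\<lambda>n. replicate (Suc r) n) \<subseteq> mono_tuples (Suc r)"
    by (auto simp: mono_tuples_def simp del: replicate_Suc)
  ultimately show ?thesis
    using infinite_super range_inj_infinite by blast
qed

subsection \<open>Expansion of the form into monomials\<close>

lemma prod_blocks:
  fixes g :: "nat \<Rightarrow> 'a :: comm_monoid_mult"
  shows "(\<Prod>p<sum_list k. g p) = (\<Prod>i<length k. \<Prod>q<k ! i. g (sum_list (take i k) + q))"
proof (induction k rule: rev_induct)
  case (snoc a k)
  have "(\<Prod>p<sum_list k + a. g p) = (\<Prod>p<sum_list k. g p) * (\<Prod>q<a. g (sum_list k + q))"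
    by (induction a) (simp_all add: mult.assoc)
  then show ?case using snoc by (simp add: nth_append cong: prod.cong_simp)
qed simp

lemma nth_concat_blocks:
  assumes len: "\<And>i. i < length k \<Longrightarrow> length (f i) = k ! i" and i: "i < length k" and q: "q < k ! i"
  shows "concat (map f [0..<length k]) ! (sum_list (take i k) + q) = f i ! q"
proof -
  have "[0..<length k] = [0..<i] @ i # [Suc i..<length k]"
    using i upt_add_eq_append[of 0 i "length k - i"] by (simp add: upt_conv_Cons)
  moreover have "length (concat (map f [0..<i])) = sum_list (take i k)"
  proof -
    have "map (length \<circ> f) [0..<i] = take i k"
      using i len by (intro nth_equalityI) auto
    then show ?thesis by (simp add: length_concat)
  qed
  ultimately show ?thesis
    using q len[OF i] by (simp add: nth_append)
qed

lemma length_concat_blocks: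
  assumes "\<And>i. i < length k \<Longrightarrow> length (f i) = k ! i"
  shows "length (concat (map f [0..<length k])) = sum_list k"
proof -
  have "map (length \<circ> f) [0..<length k] = k"
    using assms by (intro nth_equalityI) auto
  then show ?thesis by (simp add: length_concat)
qed

lemma of_real_of_rat: "complex_of_real (of_rat a) = of_rat a"
  by (cases a) (simp add: of_rat_rat)

lemma Re_of_rat: "Re (of_rat a) = of_rat a"
  by (simp flip: of_real_of_rat)

text \<open>Listed from the innermost variable outwards, like \<^const>\<open>forms\<close>.\<close>

definition exponents :: "complex \<Rightarrow> nat list \<Rightarrow> rat list \<Rightarrow> nat list \<Rightarrow> complex list" where
  "exponents \<mu> k m ns =
     concat (map (\<lambda>i. replicate (k ! i) (of_nat (ns ! i) * \<mu> + of_rat (m ! i))) [0..<length k])"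

text \<open>The subtraction from \<open>weight k\<close> reverses the order: the exponents are
  listed from the innermost variable, whereas simplex coordinates are numbered from the
  outermost.\<close>

definition zeta_monomial :: "complex \<Rightarrow> nat list \<Rightarrow> rat list \<Rightarrow> nat list \<Rightarrow> (nat \<Rightarrow> real) \<Rightarrow> complex" where
  "zeta_monomial \<mu> k m ns =
     simplex_monomial (weight k) (\<lambda>j. exponents \<mu> k m ns ! (weight k - j))"

lemma prod_reverse_interval:
  fixes g :: "nat \<Rightarrow> 'a :: comm_monoid_mult"
  shows "(\<Prod>j=1..n. g j) = (\<Prod>p<n. g (n - p))"
  by (rule prod.reindex_bij_witness[where i = "\<lambda>p. n - p" and j = "\<lambda>j. n - j"]) auto

lemma nth_exponents:
  assumes "i < length k" "q < k ! i"
  shows "exponents \<mu> k m ns ! (sum_list (take i k) + q) = of_nat (ns ! i) * \<mu> + of_rat (m ! i)"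
  unfolding exponents_def using assms by (subst nth_concat_blocks) auto

lemma length_exponents: "length (exponents \<mu> k m ns) = weight k"
  unfolding exponents_def weight_def by (rule length_concat_blocks) simp

text \<open>\<open>g\<close> stays abstract because the product is needed both for
  \<open>1 / z\<close> (the integral) and for \<open>1 / Re z\<close> (the integral of the
  norm).\<close>

lemma prod_exponents:
  fixes g :: "complex \<Rightarrow> 'a :: comm_monoid_mult"
  shows "(\<Prod>j=1..weight k. g (exponents \<mu> k m ns ! (weight k - j))) =
         (\<Prod>i<length k. g (of_nat (ns ! i) * \<mu> + of_rat (m ! i)) ^ (k ! i))"
proof -
  have "(\<Prod>j=1..weight k. g (exponents \<mu> k m ns ! (weight k - j))) =
        (\<Prod>p<sum_list k. g (exponents \<mu> k m ns ! p))"
    unfolding prod_reverse_interval by (intro prod.cong) (auto simp: weight_def)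
  also have "\<dots> = (\<Prod>i<length k. g (of_nat (ns ! i) * \<mu> + of_rat (m ! i)) ^ (k ! i))"
    unfolding prod_blocks by (intro prod.cong refl) (simp add: nth_exponents)
  finally show ?thesis .
qed

lemma Re_exponents_pos:
  assumes "positive_bi_index k m" "0 < Re \<mu>" "j \<in> {1..weight k}"
  shows "0 < Re (exponents \<mu> k m ns ! (weight k - j))"
proof -
  have "exponents \<mu> k m ns ! (weight k - j) \<in> set (exponents \<mu> k m ns)"
    using assms(3) by (intro nth_mem) (auto simp: length_exponents)
  then obtain i where i: "i < length k"
      and "exponents \<mu> k m ns ! (weight k - j) = of_nat (ns ! i) * \<mu> + of_rat (m ! i)"
    by (auto simp: exponents_def split: if_splits)
  moreover have "0 < m ! i"
    using assms(1) i by (auto simp: positive_bi_index_def bi_index_def)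
  ultimately show ?thesis
    using assms(2) by (auto simp: Re_of_rat intro!: add_nonneg_pos)
qed

lemma take_Suc_sum_list: "i < length k \<Longrightarrow> sum_list (take (Suc i) k) = sum_list (take i k) + (k ! i :: nat)"
  by (simp add: take_Suc_conv_app_nth)

text \<open>The head of each block is split off because it carries \<open>omega1\<close>, while the
  rest of the block consists of copies of \<open>omega0\<close>.\<close>

lemma prod_head_blocks:
  fixes g :: "nat \<Rightarrow> 'a :: comm_monoid_mult"
  assumes "\<forall>a\<in>set k. 1 \<le> a"
  shows "(\<Prod>p<sum_list k. g p) = (\<Prod>i<length k. g (sum_list (take i k)) *
           (\<Prod>q<k ! i - 1. g (sum_list (take i k) + Suc q)))"
  unfolding prod_blocks
proof (intro prod.cong refl)
  fix i assume "i \<in> {..<length k}"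
  then have "1 \<le> k ! i" using assms by auto
  then obtain a where "k ! i = Suc a" by (cases "k ! i") auto
  then show "(\<Prod>q<k ! i. g (sum_list (take i k) + q)) =
      g (sum_list (take i k)) * (\<Prod>q<k ! i - 1. g (sum_list (take i k) + Suc q))"
    by (simp add: prod.lessThan_Suc_shift del: prod.lessThan_Suc)
qed

lemma sum_list_take_less:
  fixes k :: "nat list"
  assumes "i < length k" "q < k ! i"
  shows "sum_list (take i k) + q < sum_list k"
proof -
  have "sum_list k = sum_list (take (Suc i) k) + sum_list (drop (Suc i) k)"
    by (metis append_take_drop_id sum_list_append)
  then show ?thesis using assms by (simp add: take_Suc_sum_list)
qed

lemma simplex_toD:
  assumes "x \<in> simplex_to n t" "j \<in> {1..n}"
  shows "0 < x j" "x j < t"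
  using assms by (auto simp: simplex_to_def)

text \<open>Exponents of the monomial are differences of consecutive accumulated exponents, lowered
  by 1. Inside a block the difference vanishes and leaves \<open>omega0\<close>; at the start of a
  block it is the increment from the previous pair (n, m) to the current one.\<close>

lemma zeta_monomial_eq:
  assumes k: "\<forall>a\<in>set k. 1 \<le> a" and x: "x \<in> simplex_to (weight k) 1"
    and ns: "ns \<in> mono_tuples (length k)"
  shows "zeta_monomial \<mu> k m ns x = (\<Prod>i<length k.
      cpow (x (weight k - sum_list (take i k)))
        (of_nat (ns ! i - (0 # ns) ! i) * \<mu> + of_rat (m ! i - (0 # m) ! i) - 1) *
      (\<Prod>q<k ! i - 1. omega0 (x (weight k - (sum_list (take i k) + Suc q)))))"
proof -
  let ?N = "weight k"
  let ?C = "exponents \<mu> k m ns"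
  have "zeta_monomial \<mu> k m ns x =
      (\<Prod>p<?N. cpow (x (?N - p)) (?C ! p - (if p = 0 then 0 else ?C ! (p - 1)) - 1))"
    unfolding zeta_monomial_def simplex_monomial_def prod_reverse_interval
    by (intro prod.cong refl) (auto simp: Suc_diff_Suc)
  also have "\<dots> = (\<Prod>i<length k.
      cpow (x (?N - sum_list (take i k)))
        (of_nat (ns ! i - (0 # ns) ! i) * \<mu> + of_rat (m ! i - (0 # m) ! i) - 1) *
      (\<Prod>q<k ! i - 1. omega0 (x (?N - (sum_list (take i k) + Suc q)))))"
    unfolding weight_def prod_head_blocks[OF k]
  proof (intro prod.cong arg_cong2[where f = "(*)"] refl)
    fix i assume "i \<in> {..<length k}"
    then have i: "i < length k" and ki: "0 < k ! i" using k by (auto simp: Suc_le_eq)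
    let ?s = "sum_list (take i k)"
    have "?C ! ?s - (if ?s = 0 then 0 else ?C ! (?s - 1)) =
        of_nat (ns ! i - (0 # ns) ! i) * \<mu> + of_rat (m ! i - (0 # m) ! i)"
    proof (cases i)
      case 0
      then show ?thesis using nth_exponents[OF i ki, of \<mu> m ns] by simp
    next
      case (Suc i')
      then have i': "i' < length k" and "0 < k ! i'" using i k by (auto simp: Suc_le_eq)
      \<comment> \<open>The position just before this block is the last one of the previous block,
        which is nonempty since all entries of \<open>k\<close> are at least 1.\<close>
      then have "?s = sum_list (take i' k) + (k ! i' - 1) + 1"
        using Suc by (simp add: take_Suc_sum_list)
      moreover have "?C ! (sum_list (take i' k) + (k ! i' - 1)) = of_nat (ns ! i') * \<mu> + of_rat (m ! i')"
        using \<open>0 < k ! i'\<close> by (intro nth_exponents i') auto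
      moreover have "ns ! i' \<le> ns ! i"
        using ns Suc i by (intro sorted_nth_mono) (auto simp: mono_tuples_def)
      ultimately show ?thesis
        using nth_exponents[OF i ki, of \<mu> m ns] Suc by (simp add: of_nat_diff of_rat_diff algebra_simps)
    qed
    then show "cpow (x (sum_list k - ?s)) (?C ! ?s - (if ?s = 0 then 0 else ?C ! (?s - 1)) - 1) =
      cpow (x (sum_list k - ?s)) (of_nat (ns ! i - (0 # ns) ! i) * \<mu> + of_rat (m ! i - (0 # m) ! i) - 1)"
      by simp
    fix q assume "q \<in> {..<k ! i - 1}"
    then have q: "Suc q < k ! i" by auto
    have "?C ! (?s + Suc q) = ?C ! (?s + Suc q - 1)"
      using nth_exponents[OF i q, of \<mu> m ns] nth_exponents[OF i, of q \<mu> m ns] q by simp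
    moreover have "0 < x (sum_list k - (?s + Suc q))"
      using sum_list_take_less[OF i q]
      by (intro simplex_toD(1)[OF x]) (auto simp: weight_def)
    ultimately show "cpow (x (sum_list k - (?s + Suc q)))
        (?C ! (?s + Suc q) - (if ?s + Suc q = 0 then 0 else ?C ! (?s + Suc q - 1)) - 1) =
      omega0 (x (sum_list k - (?s + Suc q)))"
      by (simp add: cpow_minus_one omega0_def)
  qed
  finally show ?thesis .
qed

lemma omega_form_eq:
  assumes k: "\<forall>a\<in>set k. 1 \<le> a"
  shows "omega_form \<mu> k m x = (\<Prod>i<length k.
      omega1 \<mu> (m ! i - (0 # m) ! i) (x (weight k - sum_list (take i k))) *
      (\<Prod>q<k ! i - 1. omega0 (x (weight k - (sum_list (take i k) + Suc q)))))"
proof -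
  let ?N = "weight k"
  have "omega_form \<mu> k m x = (\<Prod>p<?N. (forms \<mu> k m ! p) (x (?N - p)))"
    unfolding omega_form_def prod_reverse_interval by (intro prod.cong) auto
  also have "\<dots> = (\<Prod>i<length k.
      omega1 \<mu> (m ! i - (0 # m) ! i) (x (?N - sum_list (take i k))) *
      (\<Prod>q<k ! i - 1. omega0 (x (?N - (sum_list (take i k) + Suc q)))))"
    unfolding weight_def prod_head_blocks[OF k]
  proof (intro prod.cong arg_cong2[where f = "(*)"] refl)
    let ?f = "\<lambda>i. omega1 \<mu> (m ! i - (0 # m) ! i) # replicate (k ! i - 1) omega0"
    have k1: "1 \<le> k ! i" if "i < length k" for i using k that by auto
    have len: "length (?f i) = k ! i" if "i < length k" for i
      using k1[OF that] by simp
    fix i assume "i \<in> {..<length k}"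
    then have i: "i < length k" by simp
    have nth: "forms \<mu> k m ! (sum_list (take i k) + q) = ?f i ! q" if "q < k ! i" for q
      unfolding forms_def by (rule nth_concat_blocks[OF len i that])
    show "(forms \<mu> k m ! sum_list (take i k)) (x (sum_list k - sum_list (take i k))) =
        omega1 \<mu> (m ! i - (0 # m) ! i) (x (sum_list k - sum_list (take i k)))"
      using nth[of 0] k1[OF i] by simp
    fix q assume "q \<in> {..<k ! i - 1}"
    then show "(forms \<mu> k m ! (sum_list (take i k) + Suc q)) (x (sum_list k - (sum_list (take i k) + Suc q))) =
        omega0 (x (sum_list k - (sum_list (take i k) + Suc q)))"
      using nth[of "Suc q"] by simp
  qed
  finally show ?thesis .
qed

text \<open>A geometric series with ratio \<open>cpow t \<mu>\<close>, whose norm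
  \<open>t powr Re \<mu>\<close> is below 1; the shift by -1 in the exponent is the factor
  \<open>1 / t\<close> of the form.\<close>

lemma omega1_has_sum:
  assumes \<mu>: "0 < Re \<mu>" and t: "0 < t" "t < 1"
  shows "((\<lambda>n. \<mu> * cpow t (of_nat n * \<mu> + of_rat a - 1)) has_sum omega1 \<mu> a t) UNIV"
proof -
  have less: "norm (cpow t \<mu>) < 1"
    using powr_less_mono'[of t 0 "Re \<mu>"] \<mu> t by (simp add: norm_cpow)
  have rat: "cpow t (of_rat a) = of_real (t powr of_rat a)"
    using cpow_of_real[OF t(1), of "of_rat a"] by (simp add: of_real_of_rat)
  have summand: "\<mu> * cpow t (of_nat n * \<mu> + of_rat a - 1) = \<mu> * cpow t (of_rat a) * cpow t (-1) * cpow t \<mu> ^ n" for n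
  proof -
    have "cpow t (of_nat n * \<mu>) = cpow t \<mu> ^ n"
      by (simp add: cpow_def mult.assoc flip: exp_of_nat_mult)
    then show ?thesis
      by (simp only: diff_conv_add_uminus cpow_add) (simp add: mult_ac)
  qed
  have "((\<lambda>n. cpow t \<mu> ^ n) has_sum (1 / (1 - cpow t \<mu>))) UNIV"
    using less by (intro norm_summable_imp_has_sum geometric_sums) (simp_all add: norm_power summable_geometric)
  then have "((\<lambda>n. \<mu> * cpow t (of_rat a) * cpow t (-1) * cpow t \<mu> ^ n) has_sum
      (\<mu> * cpow t (of_rat a) * cpow t (-1) * (1 / (1 - cpow t \<mu>)))) UNIV"
    by (rule has_sum_cmult_right)
  moreover have "\<mu> * cpow t (of_rat a) * cpow t (-1) * (1 / (1 - cpow t \<mu>)) = omega1 \<mu> a t"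
    using t by (simp add: omega1_def rat cpow_minus_one cpow_eq_powr[of t \<mu>])
  ultimately show ?thesis by (simp add: summand)
qed

text \<open>Every \<open>omega1\<close> factor is expanded separately, the \<open>omega0\<close>
  factors riding along as constants. The product is multiplied out over all gap tuples, which are
  then re-indexed by weakly increasing tuples.\<close>

lemma omega_form_has_sum:
  assumes \<mu>: "0 < Re \<mu>" and k: "\<forall>a\<in>set k. 1 \<le> a"
    and x: "x \<in> simplex_to (weight k) 1"
  shows "((\<lambda>ns. \<mu> ^ length k * zeta_monomial \<mu> k m ns x) has_sum omega_form \<mu> k m x) (mono_tuples (length k))"
proof -
  let ?y = "\<lambda>i. x (weight k - sum_list (take i k))"
  let ?R = "\<lambda>i. \<Prod>q<k ! i - 1. omega0 (x (weight k - (sum_list (take i k) + Suc q)))"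
  let ?g = "\<lambda>l. \<Prod>i<length k. \<mu> * cpow (?y i) (of_nat (l i) * \<mu> + of_rat (m ! i - (0 # m) ! i) - 1) * ?R i"
  have "(?g has_sum (\<Prod>i<length k. omega1 \<mu> (m ! i - (0 # m) ! i) (?y i) * ?R i)) ({..<length k} \<rightarrow>\<^sub>E UNIV)"
  proof (intro has_sum_prod_PiE has_sum_cmult_left omega1_has_sum \<mu> finite_lessThan)
    fix i assume "i \<in> {..<length k}"
    then have i: "i < length k" "0 < k ! i" using k by (auto simp: Suc_le_eq)
    have "weight k - sum_list (take i k) \<in> {1..weight k}"
      using sum_list_take_less[OF i] by (auto simp: weight_def)
    then show "0 < ?y i" "?y i < 1" using simplex_toD[OF x] by auto
  qed
  then have "((\<lambda>ns. ?g (\<lambda>i\<in>{..<length k}. ns ! i - (0 # ns) ! i)) has_sum omega_form \<mu> k m x) (mono_tuples (length k))"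
    unfolding omega_form_eq[OF k] by (rule has_sum_mono_tuples_iff[THEN iffD2])
  moreover have "?g (\<lambda>i\<in>{..<length k}. ns ! i - (0 # ns) ! i) = \<mu> ^ length k * zeta_monomial \<mu> k m ns x"
    if "ns \<in> mono_tuples (length k)" for ns
    unfolding zeta_monomial_eq[OF k x that] by (simp add: prod.distrib mult.assoc)
  ultimately show ?thesis
    by (simp cong: has_sum_cong)
qed

subsection \<open>Integral representations\<close>

lemma zeta_monomial_integral:
  assumes "0 < Re \<mu>" "positive_bi_index k m"
  shows "set_integrable (lebesgue_pow (weight k)) (simplex_to (weight k) 1) (zeta_monomial \<mu> k m ns)"
    and "(LINT x:simplex_to (weight k) 1|lebesgue_pow (weight k). norm (zeta_monomial \<mu> k m ns x)) =
           (\<Prod>i<length k. (1 / (real (ns ! i) * Re \<mu> + of_rat (m ! i))) ^ (k ! i))"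
    and "(LINT x:simplex_to (weight k) 1|lebesgue_pow (weight k). zeta_monomial \<mu> k m ns x) =
           (\<Prod>i<length k. (1 / (of_nat (ns ! i) * \<mu> + of_rat (m ! i))) ^ (k ! i))"
proof -
  note pos = Re_exponents_pos[OF assms(2,1), of _ ns]
  show "set_integrable (lebesgue_pow (weight k)) (simplex_to (weight k) 1) (zeta_monomial \<mu> k m ns)"
    unfolding zeta_monomial_def by (rule set_integral_norm_simplex_monomial) (rule pos)
  show "(LINT x:simplex_to (weight k) 1|lebesgue_pow (weight k). norm (zeta_monomial \<mu> k m ns x)) =
           (\<Prod>i<length k. (1 / (real (ns ! i) * Re \<mu> + of_rat (m ! i))) ^ (k ! i))"
    unfolding zeta_monomial_def
    by (subst set_integral_norm_simplex_monomial(2), rule pos, assumption)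
       (subst prod_exponents[where g = "\<lambda>z. 1 / Re z"], simp add: Re_of_rat)
  show "(LINT x:simplex_to (weight k) 1|lebesgue_pow (weight k). zeta_monomial \<mu> k m ns x) =
           (\<Prod>i<length k. (1 / (of_nat (ns ! i) * \<mu> + of_rat (m ! i))) ^ (k ! i))"
    unfolding zeta_monomial_def
    by (subst set_integral_simplex_monomial, rule pos, assumption)
       (rule prod_exponents)
qed

lemma positive_bi_indexD:
  assumes "positive_bi_index k m"
  shows "length m = length k" "\<forall>a\<in>set k. 1 \<le> a" "\<And>i. i < length k \<Longrightarrow> 0 < m ! i"
  using assms by (auto simp: positive_bi_index_def bi_index_def)

lemma has_sum_set_integral:
  fixes f :: "'i \<Rightarrow> 'a \<Rightarrow> complex"
  assumes "countable A" "infinite A"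
    and "\<And>i. i \<in> A \<Longrightarrow> set_integrable M S (f i)"
    and "(\<lambda>i. LINT x:S|M. norm (f i x)) summable_on A"
    and "\<And>x. x \<in> S \<Longrightarrow> ((\<lambda>i. f i x) has_sum F x) A"
  shows "set_integrable M S F" and "((\<lambda>i. LINT x:S|M. f i x) has_sum (LINT x:S|M. F x)) A"
proof -
  have "((\<lambda>i. indicat_real S x *\<^sub>R f i x) has_sum indicat_real S x *\<^sub>R F x) A" for x
    using assms(5) by (cases "x \<in> S") auto
  moreover have "(\<lambda>i. \<integral>x. norm (indicat_real S x *\<^sub>R f i x) \<partial>M) summable_on A"
    using assms(4) by (simp add: set_lebesgue_integral_def)
  ultimately show "set_integrable M S F" and "((\<lambda>i. LINT x:S|M. f i x) has_sum (LINT x:S|M. F x)) A"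
    using has_sum_integral[OF assms(1,2), of M "\<lambda>i x. indicat_real S x *\<^sub>R f i x" "\<lambda>x. indicat_real S x *\<^sub>R F x"] assms(3)
    unfolding set_integrable_def set_lebesgue_integral_def by auto
qed

text \<open>Summability and integrability are recorded along with the identity because
  \<open>infsum\<close> and the Bochner integral default to 0 where they do not exist.\<close>

lemma zeta_mu_eq_integral:
  assumes \<mu>: "0 < Re \<mu>" and adm: "admissible k m"
  shows "zeta_summand \<mu> k m summable_on mono_tuples (length k)"
    and "set_integrable (lebesgue_pow (weight k)) (simplex_to (weight k) 1) (omega_form \<mu> k m)"
    and "zeta_mu \<mu> k m = (LINT x:simplex_to (weight k) 1|lebesgue_pow (weight k). omega_form \<mu> k m x)"
proof -
  let ?M = "lebesgue_pow (weight k)" and ?S = "simplex_to (weight k) 1"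
  have pos: "positive_bi_index k m" and ne: "k \<noteq> []" and last: "1 < last k"
    using adm by (auto simp: admissible_def)
  note k = positive_bi_indexD[OF pos]
  obtain r where r: "length k = Suc r" using ne by (cases k) auto
  have kr: "1 < k ! r" using last ne r by (simp add: last_conv_nth)
  \<comment> \<open>Admissibility gives \<open>1 < k ! r\<close>, so one factor of the last
    denominator can be split off while the remaining exponent is still at least 1. The split factor
    secures convergence.\<close>
  define e where "e i = (if i = r then k ! i - 1 else k ! i)" for i
  define f where "f ns x = \<mu> ^ length k * zeta_monomial \<mu> k m ns x" for ns x
  have int: "set_integrable ?M ?S (f ns)" for ns
    unfolding f_def using zeta_monomial_integral(1)[OF \<mu> pos] by simp
  have norm: "(LINT x:?S|?M. norm (f ns x)) =
      norm \<mu> ^ length k * (\<Prod>i<length k. (1 / (real (ns ! i) * Re \<mu> + of_rat (m ! i))) ^ (k ! i))" for ns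
    using zeta_monomial_integral(2)[OF \<mu> pos] by (simp add: f_def norm_mult norm_power)
  have "(\<lambda>ns. (\<Prod>i<Suc r. (1 / (real (ns ! i) * Re \<mu> + of_rat (m ! i))) ^ e i) *
      (1 / (real (last ns) * Re \<mu> + of_rat (m ! r)))) summable_on mono_tuples (Suc r)"
    using k kr r \<mu> by (intro summable_on_mono_tuples_powers) (auto simp: e_def)
  then have "(\<lambda>ns. norm \<mu> ^ length k * ((\<Prod>i<Suc r. (1 / (real (ns ! i) * Re \<mu> + of_rat (m ! i))) ^ e i) *
      (1 / (real (last ns) * Re \<mu> + of_rat (m ! r))))) summable_on mono_tuples (Suc r)"
    by (rule summable_on_cmult_right)
  also have "?this \<longleftrightarrow> (\<lambda>ns. LINT x:?S|?M. norm (f ns x)) summable_on mono_tuples (length k)"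
    unfolding norm r
  proof (intro summable_on_cong arg_cong2[where f = "(*)"] refl)
    fix ns assume ns: "ns \<in> mono_tuples (Suc r)"
    then have "last ns = ns ! r"
      by (subst last_conv_nth) (auto simp: mono_tuples_def)
    moreover have "y ^ (k ! r - 1) * y = y ^ (k ! r)" for y :: real
      using kr by (metis less_trans mult.commute power_minus_mult zero_less_one)
    moreover have "(\<Prod>i<r. (1 / (real (ns ! i) * Re \<mu> + of_rat (m ! i))) ^ e i) =
        (\<Prod>i<r. (1 / (real (ns ! i) * Re \<mu> + of_rat (m ! i))) ^ (k ! i))"
      by (intro prod.cong) (auto simp: e_def)
    ultimately show "(\<Prod>i<Suc r. (1 / (real (ns ! i) * Re \<mu> + of_rat (m ! i))) ^ e i) *
        (1 / (real (last ns) * Re \<mu> + of_rat (m ! r))) =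
      (\<Prod>i<Suc r. (1 / (real (ns ! i) * Re \<mu> + of_rat (m ! i))) ^ (k ! i))"
      by (simp only: prod.lessThan_Suc mult.assoc) (simp only: e_def simp_thms if_True)
  qed
  finally have summ: "(\<lambda>ns. LINT x:?S|?M. norm (f ns x)) summable_on mono_tuples (length k)" .
  have pt: "((\<lambda>ns. f ns x) has_sum omega_form \<mu> k m x) (mono_tuples (length k))" if "x \<in> ?S" for x
    unfolding f_def by (rule omega_form_has_sum[OF \<mu> k(2) that])
  note swap = has_sum_set_integral[OF countable_mono_tuples infinite_mono_tuples[of r, folded r] int summ pt]
  have "(LINT x:?S|?M. f ns x) = zeta_summand \<mu> k m ns" for ns
    unfolding f_def using zeta_monomial_integral(3)[OF \<mu> pos]
    by (simp add: zeta_summand_def power_one_over prod_dividef)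
  then have sum: "(zeta_summand \<mu> k m has_sum (LINT x:?S|?M. omega_form \<mu> k m x)) (mono_tuples (length k))"
    using swap(2) by simp
  show "set_integrable ?M ?S (omega_form \<mu> k m)" by (rule swap(1))
  show "zeta_summand \<mu> k m summable_on mono_tuples (length k)"
    using sum by (rule has_sum_imp_summable)
  show "zeta_mu \<mu> k m = (LINT x:?S|?M. omega_form \<mu> k m x)"
    unfolding zeta_mu_def using sum by (rule infsumI)
qed

section \<open>Special triples\<close>

text \<open>As the last entry of \<open>k\<close> is 1, the last block is a single position and
  belongs to the outermost variable. Its accumulated exponent enters only the power of
  \<open>x 1\<close>, so replacing \<open>last m\<close> affects that power alone.\<close>

lemma zeta_monomial_change_last:
  assumes trip: "special_triple k m m'" and x: "x \<in> simplex_to (weight k) 1"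
  shows "zeta_monomial \<mu> k m' ns x =
           of_real (x 1 powr of_rat (last m' - last m)) * zeta_monomial \<mu> k m ns x"
proof -
  have ne: "k \<noteq> []" and last: "last k = 1" and bl: "butlast m = butlast m'"
    and pos: "positive_bi_index k m" "positive_bi_index k m'"
    using trip by (auto simp: special_triple_def)
  note len = positive_bi_indexD(1)[OF pos(1)] positive_bi_indexD(1)[OF pos(2)]
  obtain r where r: "length k = Suc r" using ne by (cases k) auto
  have kr: "k ! r = 1" using last ne r by (simp add: last_conv_nth)
  have lm: "last m = m ! r" "last m' = m' ! r"
    using len r by (metis last_conv_nth diff_Suc_1 length_0_conv nat.distinct(1))+
  have mi: "m ! i = m' ! i" if "i < r" for i
    using that len r by (metis bl nth_butlast length_butlast diff_Suc_1)
  \<comment> \<open>\<open>D\<close> collects the accumulated exponents of all inner variables,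
    which the two bi-indices share.\<close>
  define D where "D = concat (map (\<lambda>i. replicate (k ! i) (of_nat (ns ! i) * \<mu> + of_rat (m ! i))) [0..<r])"
  have E: "exponents \<mu> k m ns = D @ [of_nat (ns ! r) * \<mu> + of_rat (last m)]"
    by (simp add: exponents_def D_def r kr lm)
  have E': "exponents \<mu> k m' ns = D @ [of_nat (ns ! r) * \<mu> + of_rat (last m')]"
    using mi by (auto simp: exponents_def D_def r kr lm intro!: arg_cong[where f = concat])
  have N: "weight k = Suc (length D)"
    using arg_cong[OF E, of length] by (simp add: length_exponents)
  have x1: "0 < x 1" using simplex_toD(1)[OF x, of 1] N by simp
  let ?fac = "\<lambda>m j. cpow (x j) (exponents \<mu> k m ns ! (weight k - j) -
      (if j = weight k then 0 else exponents \<mu> k m ns ! (weight k - Suc j)) - 1)"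
  have split: "zeta_monomial \<mu> k m ns x = ?fac m 1 * (\<Prod>j=2..weight k. ?fac m j)" for m
    unfolding zeta_monomial_def simplex_monomial_def
    by (subst prod.atLeast_Suc_atMost) (auto simp: N numeral_2_eq_2)
  have "(\<Prod>j=2..weight k. ?fac m' j) = (\<Prod>j=2..weight k. ?fac m j)"
    by (intro prod.cong refl) (auto simp: E E' N nth_append)
  moreover have "?fac m' 1 = of_real (x 1 powr of_rat (last m' - last m)) * ?fac m 1"
  proof -
    have "exponents \<mu> k m' ns ! (weight k - 1) = of_rat (last m' - last m) + exponents \<mu> k m ns ! (weight k - 1)"
      by (simp add: E E' N of_rat_diff)
    moreover have "(if 1 = weight k then 0 else exponents \<mu> k m' ns ! (weight k - Suc 1)) =
        (if 1 = weight k then 0 else exponents \<mu> k m ns ! (weight k - Suc 1))"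
      by (auto simp: E E' N nth_append)
    moreover have "cpow (x 1) (of_rat (last m' - last m)) = of_real (x 1 powr of_rat (last m' - last m))"
      using cpow_of_real[OF x1, of "of_rat (last m' - last m)"] by (simp add: of_real_of_rat)
    ultimately show ?thesis
      by (simp only: diff_conv_add_uminus cpow_add mult.assoc)
  qed
  ultimately show ?thesis
    by (simp only: split mult.assoc)
qed

text \<open>Since 0 < \<open>x 1\<close> < 1, the number \<open>1 - x 1 powr d\<close> with
  \<open>d = last m' - last m\<close> has the sign of \<open>d\<close> on the whole simplex. The
  norm of the difference is therefore integrated exactly, keeping a cancellation that the triangle
  inequality would lose.\<close>

lemma norm_zeta_monomial_diff:
  assumes trip: "special_triple k m m'" and x: "x \<in> simplex_to (weight k) 1"
  shows "norm (zeta_monomial \<mu> k m ns x - zeta_monomial \<mu> k m' ns x) =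
     sgn (of_rat (last m' - last m)) * (norm (zeta_monomial \<mu> k m ns x) - norm (zeta_monomial \<mu> k m' ns x))"
proof -
  let ?d = "of_rat (last m' - last m) :: real" and ?z = "zeta_monomial \<mu> k m ns x"
  have "1 \<in> set k" using trip last_in_set[of k] by (simp add: special_triple_def)
  then have "weight k \<noteq> 0" by (auto simp: weight_def)
  then have x1: "0 < x 1" "x 1 < 1" using simplex_toD[OF x, of 1] by auto
  have "?z - zeta_monomial \<mu> k m' ns x = of_real (1 - x 1 powr ?d) * ?z"
    by (simp add: zeta_monomial_change_last[OF assms] algebra_simps)
  then have "norm (?z - zeta_monomial \<mu> k m' ns x) = \<bar>1 - x 1 powr ?d\<bar> * norm ?z"
    by (simp only: norm_mult norm_of_real)
  also have "\<bar>1 - x 1 powr ?d\<bar> = sgn ?d * (1 - x 1 powr ?d)"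
    using powr_less_mono'[of "x 1" 0 ?d] powr_less_mono'[of "x 1" ?d 0] x1
    by (cases "0::real" ?d rule: linorder_cases) auto
  also have "\<dots> * norm ?z = sgn ?d * (norm ?z - norm (zeta_monomial \<mu> k m' ns x))"
    by (simp add: zeta_monomial_change_last[OF assms] norm_mult algebra_simps)
  finally show ?thesis .
qed

lemma D_mu_eq_integral:
  assumes \<mu>: "0 < Re \<mu>" and trip: "special_triple k m m'"
  shows "D_summand \<mu> k m m' summable_on mono_tuples (length k)"
    and "set_integrable (lebesgue_pow (weight k)) (simplex_to (weight k) 1)
           (\<lambda>x. omega_form \<mu> k m x - omega_form \<mu> k m' x)"
    and "D_mu \<mu> k m m' = (LINT x:simplex_to (weight k) 1|lebesgue_pow (weight k).
           omega_form \<mu> k m x - omega_form \<mu> k m' x)"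
proof -
  let ?M = "lebesgue_pow (weight k)" and ?S = "simplex_to (weight k) 1"
  have ne: "k \<noteq> []" and last: "last k = 1" and bl: "butlast m = butlast m'" and neq: "last m \<noteq> last m'"
    and pos: "positive_bi_index k m" "positive_bi_index k m'"
    using trip by (auto simp: special_triple_def)
  note k = positive_bi_indexD[OF pos(1)] and k' = positive_bi_indexD[OF pos(2)]
  obtain r where r: "length k = Suc r" using ne by (cases k) auto
  have kr: "k ! r = 1" using last ne r by (simp add: last_conv_nth)
  have lm: "last m = m ! r" "last m' = m' ! r"
    using k(1) k'(1) r by (metis last_conv_nth diff_Suc_1 length_0_conv nat.distinct(1))+
  have mi: "m ! i = m' ! i" if "i < r" for i
    using that k(1) k'(1) r by (metis bl nth_butlast length_butlast diff_Suc_1)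
  define d where "d = last m' - last m"
  have pm: "0 < last m" "0 < last m'" using k(3) k'(3) r lm by auto
  define f where "f ns x = \<mu> ^ length k * (zeta_monomial \<mu> k m ns x - zeta_monomial \<mu> k m' ns x)" for ns x
  have int: "set_integrable ?M ?S (f ns)" for ns
    unfolding f_def using zeta_monomial_integral(1)[OF \<mu> pos(1)] zeta_monomial_integral(1)[OF \<mu> pos(2)]
    by (simp add: set_integral_diff)
  have norm: "(LINT x:?S|?M. norm (f ns x)) = norm \<mu> ^ length k * \<bar>of_rat d\<bar> *
      ((\<Prod>i<Suc r. (1 / (real (ns ! i) * Re \<mu> + of_rat (m ! i))) ^ (k ! i)) *
        (1 / (real (last ns) * Re \<mu> + of_rat (last m'))))"
    if ns: "ns \<in> mono_tuples (length k)" for ns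
  proof -
    have ln: "last ns = ns ! r"
      using ns r by (subst last_conv_nth) (auto simp: mono_tuples_def)
    let ?P = "\<Prod>i<r. (1 / (real (ns ! i) * Re \<mu> + of_rat (m ! i))) ^ (k ! i)"
    let ?a = "real (last ns) * Re \<mu> + of_rat (last m)" and ?a' = "real (last ns) * Re \<mu> + of_rat (last m')"
    have a: "0 < ?a" "0 < ?a'" using \<mu> pm by (auto intro!: add_nonneg_pos)
    have nint: "set_integrable ?M ?S (\<lambda>x. norm (zeta_monomial \<mu> k m ns x))"
        "set_integrable ?M ?S (\<lambda>x. norm (zeta_monomial \<mu> k m' ns x))"
      using zeta_monomial_integral(1)[OF \<mu> pos(1)] zeta_monomial_integral(1)[OF \<mu> pos(2)]
      by (auto intro: set_integrable_norm)
    have "(LINT x:?S|?M. norm (f ns x)) = (LINT x:?S|?M. norm \<mu> ^ length k * sgn (of_rat d) *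
        (norm (zeta_monomial \<mu> k m ns x) - norm (zeta_monomial \<mu> k m' ns x)))"
      by (rule set_lebesgue_integral_cong)
         (auto simp: f_def norm_mult norm_power norm_zeta_monomial_diff[OF trip] d_def)
    also have "\<dots> = norm \<mu> ^ length k * sgn (of_rat d) *
        ((LINT x:?S|?M. norm (zeta_monomial \<mu> k m ns x)) - (LINT x:?S|?M. norm (zeta_monomial \<mu> k m' ns x)))"
      by (simp only: set_integral_mult_right set_integral_diff(2)[OF nint])
    also have "\<dots> = norm \<mu> ^ length k * sgn (of_rat d) * (?P * (1 / ?a) - ?P * (1 / ?a'))"
      using mi unfolding zeta_monomial_integral(2)[OF \<mu> pos(1)] zeta_monomial_integral(2)[OF \<mu> pos(2)] r
      by (simp add: kr lm ln)
    \<comment> \<open>Partial fractions: the difference of the two reciprocals has both last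
      denominators, which is where the extra decay comes from.\<close>
    also have "?P * (1 / ?a) - ?P * (1 / ?a') = of_rat d * (?P * (1 / ?a) * (1 / ?a'))"
      using a by (simp add: d_def of_rat_diff field_simps)
    also have "norm \<mu> ^ length k * sgn (of_rat d) * (of_rat d * (?P * (1 / ?a) * (1 / ?a'))) =
        norm \<mu> ^ length k * \<bar>of_rat d\<bar> * (?P * (1 / ?a) * (1 / ?a'))"
      by (simp add: abs_sgn mult_ac)
    finally show ?thesis by (simp add: kr lm ln)
  qed
  have "(\<lambda>ns. norm \<mu> ^ length k * \<bar>of_rat d\<bar> *
      ((\<Prod>i<Suc r. (1 / (real (ns ! i) * Re \<mu> + of_rat (m ! i))) ^ (k ! i)) *
        (1 / (real (last ns) * Re \<mu> + of_rat (last m'))))) summable_on mono_tuples (Suc r)"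
    using k r \<mu> pm by (intro summable_on_cmult_right summable_on_mono_tuples_powers) auto
  then have summ: "(\<lambda>ns. LINT x:?S|?M. norm (f ns x)) summable_on mono_tuples (length k)"
    unfolding r[symmetric] by (simp only: norm r[symmetric] cong: summable_on_cong)
  \<comment> \<open>Pointwise on the open simplex each expansion converges by itself, so the two can
    be subtracted term by term; the cancellation matters only after integration.\<close>
  have pt: "((\<lambda>ns. f ns x) has_sum (omega_form \<mu> k m x - omega_form \<mu> k m' x)) (mono_tuples (length k))"
    if "x \<in> ?S" for x
    using has_sum_add[OF omega_form_has_sum[OF \<mu> k(2) that]
        has_sum_cmult_right[OF omega_form_has_sum[OF \<mu> k'(2) that], of "-1"]]
    by (simp add: f_def right_diff_distrib)
  note swap = has_sum_set_integral[OF countable_mono_tuples infinite_mono_tuples[of r, folded r] int summ pt]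
  have val: "(LINT x:?S|?M. f ns x) = of_rat d * D_summand \<mu> k m m' ns"
    if ns: "ns \<in> mono_tuples (length k)" for ns
  proof -
    have ln: "last ns = ns ! r"
      using ns r by (subst last_conv_nth) (auto simp: mono_tuples_def)
    let ?P = "\<Prod>i<r. (1 / (of_nat (ns ! i) * \<mu> + of_rat (m ! i))) ^ (k ! i)"
    let ?a = "of_nat (last ns) * \<mu> + of_rat (last m)" and ?a' = "of_nat (last ns) * \<mu> + of_rat (last m')"
    have "0 < Re ?a" "0 < Re ?a'" using \<mu> pm by (auto intro!: add_nonneg_pos simp: Re_of_rat)
    then have a: "?a \<noteq> 0" "?a' \<noteq> 0" by (metis less_irrefl zero_complex.simps(1))+
    have "(LINT x:?S|?M. f ns x) = \<mu> ^ length k *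
        ((LINT x:?S|?M. zeta_monomial \<mu> k m ns x) - (LINT x:?S|?M. zeta_monomial \<mu> k m' ns x))"
      using zeta_monomial_integral(1)[OF \<mu> pos(1)] zeta_monomial_integral(1)[OF \<mu> pos(2)]
      by (simp add: f_def set_integral_diff)
    also have "\<dots> = \<mu> ^ length k * (?P * (1 / ?a) - ?P * (1 / ?a'))"
      using mi unfolding zeta_monomial_integral(3)[OF \<mu> pos(1)] zeta_monomial_integral(3)[OF \<mu> pos(2)] r
      by (simp add: kr lm ln)
    also have "?P * (1 / ?a) - ?P * (1 / ?a') = of_rat d * (?P * (1 / ?a) * (1 / ?a'))"
      using a by (simp add: d_def of_rat_diff divide_simps) (simp add: algebra_simps)
    also have "\<mu> ^ length k * (of_rat d * (?P * (1 / ?a) * (1 / ?a'))) = of_rat d * D_summand \<mu> k m m' ns"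
      by (simp add: D_summand_def r power_one_over prod_dividef)
    finally show ?thesis .
  qed
  have sum: "((\<lambda>ns. of_rat d * D_summand \<mu> k m m' ns) has_sum
      (LINT x:?S|?M. omega_form \<mu> k m x - omega_form \<mu> k m' x)) (mono_tuples (length k))"
    using swap(2) val by (simp cong: has_sum_cong)
  show "set_integrable ?M ?S (\<lambda>x. omega_form \<mu> k m x - omega_form \<mu> k m' x)"
    by (rule swap(1))
  \<comment> \<open>The exchange gives summability of the series scaled by \<open>d\<close>;
    removing the scalar uses \<open>last m \<noteq> last m'\<close>.\<close>
  have "of_rat d \<noteq> (0 :: complex)" using neq by (simp add: d_def)
  then show "D_summand \<mu> k m m' summable_on mono_tuples (length k)"
    using has_sum_imp_summable[OF sum] by (simp add: summable_on_cmult_right')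
  show "D_mu \<mu> k m m' = (LINT x:?S|?M. omega_form \<mu> k m x - omega_form \<mu> k m' x)"
    unfolding D_mu_def using infsumI[OF sum] by (simp add: infsum_cmult_right' d_def)
qed

theorem theorem1p2:
  fixes \<mu> :: complex
  assumes "Re \<mu> > 0"
  shows
    "(\<forall>k m. admissible k m \<longrightarrow>
        zeta_summand \<mu> k m summable_on mono_tuples (length k) \<and>
        set_integrable (lebesgue_pow (weight k)) (simplex_to (weight k) 1) (omega_form \<mu> k m) \<and>
        zeta_mu \<mu> k m =
          (LINT x:simplex_to (weight k) 1|lebesgue_pow (weight k). omega_form \<mu> k m x)) \<and>
     (\<forall>k m m'. special_triple k m m' \<longrightarrow>
        D_summand \<mu> k m m' summable_on mono_tuples (length k) \<and>
        set_integrable (lebesgue_pow (weight k)) (simplex_to (weight k) 1)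
          (\<lambda>x. omega_form \<mu> k m x - omega_form \<mu> k m' x) \<and>
        D_mu \<mu> k m m' =
          (LINT x:simplex_to (weight k) 1|lebesgue_pow (weight k).
             omega_form \<mu> k m x - omega_form \<mu> k m' x))"
  using zeta_mu_eq_integral[OF assms] D_mu_eq_integral[OF assms] by blast

end
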